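(* Let $v$ be a self-similar weak solution of $u_t+f(u)_x=0$, with associated sets $\mathcal S$ (ess-im discontinuity points), $\mathcal C$ (non-resonant ess-im continuity points) and $\mathcal W$ (resonant ess-im continuity points). Then the set $\mathcal S\sqcup\mathcal W$ is closed in $\mathbb R$ and the set $\mathcal C$ is open in $\mathbb R$.
   Context: Let $n\ge 1$, let $\mathbb U\subseteq\mathbb R^n$ be open, let $f:\mathbb U\to\mathbb R^n$ be $C^2$, and $A:=Df$. $\mathbb U_{SH}\subseteq\mathbb U$ is the set of states $u$ at which $A(u)$ has $n$ real, distinct eigenvalues. It is assumed that the convex hull of $\mathbb U_{SH}$ is contained in $\mathbb U$. For $v\in L^\infty(\mathbb R;\mathbb R^n)$ and measurable $J\subseteq\mathbb R$, $\operatorname{ess\,im} v|_J$ is the set of $u\in\mathbb R^n$ such that $v^{-1}[U]\cap J$ has positive Lebesgue measure for every neighborhood $U$ of $u$; $\operatorname{ess\,im}v:=\operatorname{ess\,im}v|_{\mathbb R}$. Set $\mathcal A(v;\xi):=\bigcap_{r>0}\operatorname{ess\,im}v|_{(\xi-r,\xi+r)}$. The point $\xi$ is an ess-im continuity point for $v$ if $\mathcal A(v;\xi)$ is a singleton, whose element is denoted $\overline v(\xi)$; otherwise it is an ess-im discontinuity point. A self-similar weak solution is a function $v\in L^\infty(\mathbb R;\mathbb R^n)$ with $\operatorname{ess\,im}v\subseteq\mathbb U_{SH}$ such that $\int_{-\infty}^\infty\{\frac{d\psi}{d\xi}\cdot[-\xi v+f(v)]-\psi\cdot v\}\,d\xi=0$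 for all $\psi\in C^1_c(\mathbb R;\mathbb R^n)$. For such $v$: $\mathcal S$ is the set of ess-im discontinuity points of $v$; $\mathcal C$ is the set of ess-im continuity points $\xi$ with $\det[-\xi I+A(\overline v(\xi))]\ne0$; $\mathcal W$ is the set of ess-im continuity points $\xi$ with $\det[-\xi I+A(\overline v(\xi))]=0$. Thus $\mathbb R=\mathcal S\sqcup\mathcal C\sqcup\mathcal W$. *)

theory Defs
  imports "HOL-Analysis.Analysis"
begin

definition C1_on ::
  "('a::real_normed_vector \<Rightarrow> 'b::real_normed_vector) \<Rightarrow> 'a set \<Rightarrow> bool" where
  "C1_on f U \<longleftrightarrow>
     (\<exists>f' :: 'a \<Rightarrow> 'a \<Rightarrow>\<^sub>L 'b.
        (\<forall>x\<in>U. (f has_derivative blinfun_apply (f' x)) (at x)) \<and> continuous_on U f')"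

definition C2_on ::
  "('a::real_normed_vector \<Rightarrow> 'b::real_normed_vector) \<Rightarrow> 'a set \<Rightarrow> bool" where
  "C2_on f U \<longleftrightarrow>
     (\<exists>f' :: 'a \<Rightarrow> 'a \<Rightarrow>\<^sub>L 'b.
        (\<forall>x\<in>U. (f has_derivative blinfun_apply (f' x)) (at x)) \<and> C1_on f' U)"

definition real_eigenvalue :: "real^'n^'n \<Rightarrow> real \<Rightarrow> bool" where
  "real_eigenvalue M l \<longleftrightarrow> (\<exists>r. r \<noteq> 0 \<and> M *v r = l *\<^sub>R r)"

text \<open>A flux \<open>f\<close> on \<open>U\<close> is represented by a total function whose values outside \<open>U\<close> are
  irrelevant; its derivative \<open>A = Df\<close> is the Jacobian matrix \<open>jacobian f (at u)\<close>.\<close>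

definition strictly_hyperbolic_set ::
  "(real^'n \<Rightarrow> real^'n) \<Rightarrow> (real^'n) set \<Rightarrow> (real^'n) set" where
  "strictly_hyperbolic_set f U =
     {u \<in> U. card {l. real_eigenvalue (jacobian f (at u)) l} = CARD('n)}"

text \<open>Elements of \<open>L\<^sup>\<infinity>\<close> are represented by functions rather than by classes modulo
  a.e. equality; all notions below are invariant under changes on null sets.\<close>

definition L_infinity :: "(real \<Rightarrow> 'a::real_normed_vector) \<Rightarrow> bool" where
  "L_infinity v \<longleftrightarrow>
     v \<in> borel_measurable lebesgue \<and> (\<exists>B. AE \<xi> in lebesgue. norm (v \<xi>) \<le> B)"

definition ess_im :: "(real \<Rightarrow> 'a::topological_space) \<Rightarrow> real set \<Rightarrow> 'a set" where
  "ess_im v J = {u. \<forall>V. open V \<and> u \<in> V \<longrightarrow> emeasure lebesgue (v -` V \<inter> J) > 0}"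

definition ess_im_at :: "(real \<Rightarrow> 'a::topological_space) \<Rightarrow> real \<Rightarrow> 'a set" where
  "ess_im_at v \<xi> = (\<Inter>r\<in>{0<..}. ess_im v {\<xi> - r<..<\<xi> + r})"

definition ess_im_continuity_point :: "(real \<Rightarrow> 'a::topological_space) \<Rightarrow> real \<Rightarrow> bool" where
  "ess_im_continuity_point v \<xi> \<longleftrightarrow> is_singleton (ess_im_at v \<xi>)"

text \<open>The value of \<open>v\<close> at an ess-im continuity point; meaningless elsewhere.\<close>

definition ess_im_value :: "(real \<Rightarrow> 'a::topological_space) \<Rightarrow> real \<Rightarrow> 'a" where
  "ess_im_value v \<xi> = the_elem (ess_im_at v \<xi>)"

definition C1c :: "(real \<Rightarrow> 'a::real_normed_vector) \<Rightarrow> bool" where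
  "C1c \<psi> \<longleftrightarrow> \<psi> C1_differentiable_on UNIV \<and> compact (closure {\<xi>. \<psi> \<xi> \<noteq> 0})"

definition self_similar_weak_solution ::
  "(real^'n \<Rightarrow> real^'n) \<Rightarrow> (real^'n) set \<Rightarrow> (real \<Rightarrow> real^'n) \<Rightarrow> bool" where
  "self_similar_weak_solution f U v \<longleftrightarrow>
     L_infinity v \<and>
     ess_im v UNIV \<subseteq> strictly_hyperbolic_set f U \<and>
     (\<forall>\<psi>. C1c \<psi> \<longrightarrow>
        has_bochner_integral lebesgue
          (\<lambda>\<xi>. vector_derivative \<psi> (at \<xi>) \<bullet> (- \<xi> *\<^sub>R v \<xi> + f (v \<xi>)) - \<psi> \<xi> \<bullet> v \<xi>) 0)"

definition discontinuity_set :: "(real \<Rightarrow> real^'n) \<Rightarrow> real set" where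
  "discontinuity_set v = {\<xi>. \<not> ess_im_continuity_point v \<xi>}"

definition nonresonant_set :: "(real^'n \<Rightarrow> real^'n) \<Rightarrow> (real \<Rightarrow> real^'n) \<Rightarrow> real set" where
  "nonresonant_set f v =
     {\<xi>. ess_im_continuity_point v \<xi> \<and>
          det (- \<xi> *\<^sub>R mat 1 + jacobian f (at (ess_im_value v \<xi>))) \<noteq> 0}"

definition resonant_set :: "(real^'n \<Rightarrow> real^'n) \<Rightarrow> (real \<Rightarrow> real^'n) \<Rightarrow> real set" where
  "resonant_set f v =
     {\<xi>. ess_im_continuity_point v \<xi> \<and>
          det (- \<xi> *\<^sub>R mat 1 + jacobian f (at (ess_im_value v \<xi>))) = 0}"

lemma discontinuity_nonresonant_resonant_partition:
  "discontinuity_set v \<union> nonresonant_set f v \<union> resonant_set f v = UNIV"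
  "discontinuity_set v \<inter> nonresonant_set f v = {}"
  "discontinuity_set v \<inter> resonant_set f v = {}"
  "nonresonant_set f v \<inter> resonant_set f v = {}"
  by (auto simp: discontinuity_set_def nonresonant_set_def resonant_set_def)

end

theory Submission
  imports Defs
begin

text \<open>
  The weak form says that \<open>G(\<xi>) = f(v(\<xi>)) - \<xi> v(\<xi>)\<close> has distributional derivative \<open>-v\<close>.
  Near a point \<open>\<xi>\<^sub>0\<close> of the non-resonant set, \<open>v\<close> takes almost all its values in a small ball around
  \<open>u\<^sub>0\<close>, the value at \<open>\<xi>\<^sub>0\<close>, so \<open>G\<close> is essentially Lipschitz there: on an interval of
  length \<open>2r\<close> it is within \<open>O(r)\<close> of a constant. Hence \<open>u \<mapsto> f(u) - \<xi> u\<close> is constant on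
  the essential image of \<open>v\<close> at any \<open>\<xi>\<close> close to \<open>\<xi>\<^sub>0\<close>. As \<open>A(u\<^sub>0) - \<xi>\<^sub>0 I\<close> is invertible, this
  map is injective on the ball, so the essential image at \<open>\<xi>\<close> is a singleton, and its
  element is still non-resonant.
\<close>

section \<open>Test functions on a bounded interval\<close>

text \<open>One-sided fundamental lemma of the calculus of variations. Mere continuity of
  \<open>\<phi>\<close> is the right class of tests, because \<open>\<phi>\<close> will enter the
  weak form only through the derivative of a C1 function; the strict inequalities on
  \<open>p\<close> and \<open>q\<close> keep the support away from the endpoints.\<close>

lemma AE_nonpos_if_integral_nonpos:
  fixes h :: "real \<Rightarrow> real"
  assumes h: "integrable (lebesgue_on {a<..<b}) h"
    and le: "\<And>\<phi> p q. \<lbrakk>continuous_on UNIV \<phi>; \<And>x. 0 \<le> \<phi> x; a < p; q < b;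
               \<And>x. x \<notin> {p..q} \<Longrightarrow> \<phi> x = 0\<rbrakk>
             \<Longrightarrow> (LINT x|lebesgue_on {a<..<b}. \<phi> x * h x) \<le> 0"
  shows "AE x in lebesgue_on {a<..<b}. h x \<le> 0"
proof -
  let ?M = "lebesgue_on {a<..<b}"
  have hm [measurable]: "h \<in> borel_measurable ?M" using h by auto
  define E where "E = {x \<in> space ?M. 0 < h x}"
  have "E \<in> sets ?M" unfolding E_def by measurable
  then have "E \<in> sets lebesgue"
    by (simp add: sets_restrict_space_iff)
  \<comment> \<open>Test with continuous functions converging a.e. to the indicator of \<open>{h > 0}\<close>.\<close>
  then have "indicat_real E measurable_on UNIV" by (rule indicator_measurable_on)
  then obtain N g where N: "negligible N" and g: "\<And>n. continuous_on UNIV (g n)"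
    and lim: "\<And>x. x \<notin> N \<Longrightarrow> (\<lambda>n. g n x) \<longlonglongrightarrow> indicat_real E x"
    unfolding measurable_on_def by auto
  \<comment> \<open>\<open>cut n\<close> vanishes outside the interval and within distance 1/n of
    its endpoints, and is 1 from distance 2/n on. Clipping \<open>g n\<close> to the unit interval
    makes \<open>\<phi> n\<close> nonnegative and bounded by 1, and preserves a limit that is 0 or
    1.\<close>
  define cut :: "nat \<Rightarrow> real \<Rightarrow> real"
    where "cut n x = max 0 (min 1 (real n * min (x - a) (b - x) - 1))" for n x
  define \<phi> where "\<phi> n x = max 0 (min 1 (g n x)) * cut n x" for n x
  have cut01: "0 \<le> cut n x" "cut n x \<le> 1" for n x unfolding cut_def by auto
  have phi01: "0 \<le> \<phi> n x" "\<phi> n x \<le> 1" for n x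
    unfolding \<phi>_def using cut01[of n x] by (auto intro: mult_le_one)
  have cont: "continuous_on UNIV (\<phi> n)" for n
    unfolding \<phi>_def cut_def by (intro continuous_intros g)
  have [measurable]: "\<phi> n \<in> borel_measurable ?M" for n
    by (intro continuous_imp_measurable_on_sets_lebesgue continuous_on_subset[OF cont]) auto
  have cutlim: "(\<lambda>n. cut n x) \<longlonglongrightarrow> 1" if "x \<in> {a<..<b}" for x
  proof (rule tendsto_eventually)
    define d where "d = min (x - a) (b - x)"
    have "d > 0" using that by (auto simp: d_def)
    have "\<forall>\<^sub>F n in sequentially. 2 / d \<le> real n"
      using filterlim_real_sequentially by (simp add: filterlim_at_top)
    then show "\<forall>\<^sub>F n in sequentially. cut n x = 1"
    proof eventually_elim
      case (elim n)
      then have "2 \<le> real n * d" using \<open>d > 0\<close> by (simp add: field_simps)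
      then show ?case unfolding cut_def d_def[symmetric] by auto
    qed
  qed
  have philim: "(\<lambda>n. \<phi> n x) \<longlonglongrightarrow> indicat_real E x" if "x \<in> {a<..<b}" "x \<notin> N" for x
  proof -
    have "(\<lambda>n. \<phi> n x) \<longlonglongrightarrow> max 0 (min 1 (indicat_real E x)) * 1"
      unfolding \<phi>_def by (intro tendsto_intros lim cutlim that)
    moreover have "max 0 (min 1 (indicat_real E x)) * 1 = indicat_real E x"
      by (auto simp: indicator_def)
    ultimately show ?thesis by simp
  qed
  \<comment> \<open>For \<open>n = 0\<close> the quotient \<open>1 / n\<close> is 0, so
    \<open>p\<close> would be the endpoint \<open>a\<close> itself; there \<open>cut 0\<close> is
    identically 0 instead.\<close>
  have phi_le: "(LINT x|?M. \<phi> n x * h x) \<le> 0" for n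
  proof (cases "n = 0")
    case True
    then have "\<phi> n x = 0" for x by (simp add: \<phi>_def cut_def)
    then show ?thesis by simp
  next
    case False
    show ?thesis
    proof (rule le[where p = "a + 1 / n" and q = "b - 1 / n"])
      fix x assume "x \<notin> {a + 1 / n..b - 1 / n}"
      then have "real n * (x - a) \<le> 1 \<or> real n * (b - x) \<le> 1"
        using False by (auto simp: field_simps)
      moreover have "real n * min (x - a) (b - x) \<le> real n * (x - a)"
        "real n * min (x - a) (b - x) \<le> real n * (b - x)"
        by (auto intro!: mult_left_mono)
      ultimately have "real n * min (x - a) (b - x) \<le> 1" by linarith
      then show "\<phi> n x = 0" by (simp add: \<phi>_def cut_def)
    qed (use False cont phi01 in auto)
  qed
  have notN: "AE x in ?M. x \<notin> N"
  proof -
    have "AE x in lebesgue. x \<notin> N"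
      using N by (simp add: negligible_iff_null_sets AE_not_in)
    then show ?thesis by (auto simp: AE_restrict_space_iff elim: eventually_mono)
  qed
  have "(\<lambda>n. LINT x|?M. \<phi> n x * h x) \<longlonglongrightarrow> (LINT x|?M. indicat_real E x * h x)"
  proof (rule integral_dominated_convergence)
    show "integrable ?M (\<lambda>x. \<bar>h x\<bar>)" using h by simp
    show "AE x in ?M. (\<lambda>n. \<phi> n x * h x) \<longlonglongrightarrow> indicat_real E x * h x"
      using notN AE_space by eventually_elim (auto intro!: tendsto_intros philim)
    show "AE x in ?M. norm (\<phi> n x * h x) \<le> \<bar>h x\<bar>" for n
      using phi01[of n] by (intro AE_I2) (auto simp: abs_mult intro: mult_left_le_one_le)
    show "(\<lambda>x. indicat_real E x * h x) \<in> borel_measurable ?M" 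
      using \<open>E \<in> sets ?M\<close> by measurable
  qed measurable
  then have le0: "(LINT x|?M. indicat_real E x * h x) \<le> 0"
    by (rule LIMSEQ_le_const2) (use phi_le in auto)
  have int: "integrable ?M (\<lambda>x. indicat_real E x * h x)"
    using integrable_mult_indicator[OF \<open>E \<in> sets ?M\<close> h] by simp
  have nn: "AE x in ?M. 0 \<le> indicat_real E x * h x"
    by (intro AE_I2) (auto simp: E_def indicator_def)
  have "(LINT x|?M. indicat_real E x * h x) = 0"
    using le0 integral_nonneg_AE[OF nn] by linarith
  then have "AE x in ?M. indicat_real E x * h x = 0"
    using integral_nonneg_eq_0_iff_AE[OF int nn] by simp
  then show ?thesis
    using AE_space by eventually_elim (auto simp: E_def indicator_def split: if_splits)
qed

text \<open>The antiderivative of \<open>\<kappa>\<close> from \<open>p\<close> is zero left of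
  \<open>p\<close> by the support condition and returns to zero right of \<open>q\<close> because
  the mean vanishes. Bounding it by the L1 norm of \<open>\<kappa>\<close> makes the later estimate
  proportional to the mass of the test density.\<close>

lemma zero_mean_test_function:
  fixes \<kappa> :: "real \<Rightarrow> real"
  assumes cont: "continuous_on UNIV \<kappa>" and supp: "\<And>x. x \<notin> {p..q} \<Longrightarrow> \<kappa> x = 0"
    and mean: "integral UNIV \<kappa> = 0"
  obtains \<psi> where "\<And>x. (\<psi> has_vector_derivative \<kappa> x) (at x)"
    "\<And>x. x \<notin> {p..q} \<Longrightarrow> \<psi> x = 0" "\<And>x. \<bar>\<psi> x\<bar> \<le> integral UNIV (\<lambda>x. \<bar>\<kappa> x\<bar>)"
proof -
  define \<psi> where "\<psi> x = integral {p..x} \<kappa>" for x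
  have int: "\<kappa> integrable_on {c..d}" "(\<lambda>x. \<bar>\<kappa> x\<bar>) integrable_on {c..d}" for c d
    by (auto intro!: integrable_continuous_real continuous_intros continuous_on_subset[OF cont])
  have intU: "(\<lambda>x. \<bar>\<kappa> x\<bar>) integrable_on UNIV"
    by (rule integrable_on_superset[OF int(2)[of p q]]) (use supp in auto)
  \<comment> \<open>For \<open>x < p\<close> the interval \<open>{p..x}\<close> is empty and
    \<open>\<psi> x\<close> is 0. Moving the base point to any \<open>c \<le> p\<close> gives one
    formula on both sides of \<open>p\<close>, and \<open>c\<close> can be taken so small that
    \<open>x\<close> is interior when differentiating.\<close>
  have low: "\<psi> x = integral {c..x} \<kappa>" if "c \<le> p" for c x
    unfolding \<psi>_def
    by (rule integral_spike_set; rule negligible_subset[of "{}"]) (use that supp in auto)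
  have der: "(\<psi> has_vector_derivative \<kappa> x) (at x)" for x
  proof -
    define c where "c = min p x - 1"
    have "((\<lambda>u. integral {c..u} \<kappa>) has_vector_derivative \<kappa> x) (at x within {c..x+1})"
      by (rule integral_has_vector_derivative)
         (auto simp: c_def intro: continuous_on_subset[OF cont])
    then have "((\<lambda>u. integral {c..u} \<kappa>) has_vector_derivative \<kappa> x) (at x)"
      by (subst (asm) at_within_interior) (auto simp: c_def)
    moreover have "(\<lambda>u. integral {c..u} \<kappa>) = \<psi>"
      using low[of c] by (auto simp: c_def)
    ultimately show ?thesis by simp
  qed
  have zero: "\<psi> x = 0" if "x \<notin> {p..q}" for x
  proof (cases "x < p")
    case True
    then show ?thesis by (simp add: \<psi>_def)
  next
    case False
    then have "q < x" using that by auto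
    have "integral {p..x} \<kappa> = integral UNIV \<kappa>"
      by (rule integral_spike_set; rule negligible_subset[of "{}"]) (use \<open>q < x\<close> supp in fastforce)+
    then show ?thesis using mean by (simp add: \<psi>_def)
  qed
  have bound: "\<bar>\<psi> x\<bar> \<le> integral UNIV (\<lambda>x. \<bar>\<kappa> x\<bar>)" for x
  proof -
    have "\<bar>\<psi> x\<bar> \<le> integral {p..x} (\<lambda>x. \<bar>\<kappa> x\<bar>)"
      unfolding \<psi>_def using integral_norm_bound_integral[OF int(1) int(2)] by simp
    also have "\<dots> \<le> integral UNIV (\<lambda>x. \<bar>\<kappa> x\<bar>)"
      by (rule integral_subset_le) (use int intU in auto)
    finally show ?thesis .
  qed
  show ?thesis using der zero bound by (rule that)
qed

section \<open>Oscillation of a function with bounded weak derivative\<close>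

lemma integrable_continuous_mult:
  fixes \<phi> G :: "real \<Rightarrow> real"
  assumes cont: "continuous_on UNIV \<phi>" and supp: "\<And>x. x \<notin> {p..q} \<Longrightarrow> \<phi> x = 0"
    and G: "integrable (lebesgue_on S) G" and S: "S \<in> sets lebesgue"
  shows "integrable (lebesgue_on S) (\<lambda>x. \<phi> x * G x)"
proof -
  have "compact (\<phi> ` {p..q})"
    by (intro compact_continuous_image continuous_on_subset[OF cont]) auto
  then obtain B where B: "\<And>y. y \<in> \<phi> ` {p..q} \<Longrightarrow> norm y \<le> B"
    using compact_imp_bounded bounded_iff by metis
  have le: "\<bar>\<phi> x\<bar> \<le> \<bar>B\<bar>" for x
    using supp[of x] B[of "\<phi> x"] by (cases "x \<in> {p..q}") auto
  have [measurable]: "\<phi> \<in> borel_measurable (lebesgue_on S)"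
    by (intro continuous_imp_measurable_on_sets_lebesgue continuous_on_subset[OF cont] S) auto
  show ?thesis
  proof (rule Bochner_Integration.integrable_bound)
    show "integrable (lebesgue_on S) (\<lambda>x. \<bar>B\<bar> * G x)" using G by simp
    show "AE x in lebesgue_on S. norm (\<phi> x * G x) \<le> norm (\<bar>B\<bar> * G x)"
      using le by (intro AE_I2) (auto simp: abs_mult intro!: mult_right_mono)
  qed (use G in measurable)
qed

text \<open>
  A nonnegative test density \<open>\<phi>\<close> minus its mass times a fixed bump \<open>\<rho>\<close> has mean zero, so it is the
  derivative of an admissible \<open>\<psi>\<close>, bounded by twice the mass of \<open>\<phi>\<close>; the constant is
  \<open>g = \<integral> \<rho> G\<close>.
\<close>

lemma weak_derivative_oscillation_bound_real:
  fixes G v :: "real \<Rightarrow> real"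
  assumes ab: "a < b" and M: "0 \<le> M"
    and G: "integrable (lebesgue_on {a<..<b}) G" and v: "integrable (lebesgue_on {a<..<b}) v"
    and vM: "AE x in lebesgue_on {a<..<b}. \<bar>v x\<bar> \<le> M"
    and weak: "\<And>\<psi> \<phi> p q. \<lbrakk>\<And>x. (\<psi> has_vector_derivative \<phi> x) (at x); continuous_on UNIV \<phi>;
       a < p; q < b; \<And>x. x \<notin> {p..q} \<Longrightarrow> \<psi> x = 0;
       \<And>x. x \<notin> {p..q} \<Longrightarrow> \<phi> x = 0\<rbrakk>
       \<Longrightarrow> (LINT x|lebesgue_on {a<..<b}. \<phi> x * G x - \<psi> x * v x) = 0"
  obtains g where "AE x in lebesgue_on {a<..<b}. \<bar>G x - g\<bar> \<le> 2 * M * (b - a)"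
proof -
  let ?K = "{a<..<b}"
  let ?M = "lebesgue_on ?K"
  \<comment> \<open>Ninths leave room for a tent \<open>\<rho>0\<close> supported at distance
    \<open>2*w\<close> from both ends and of height at least \<open>w\<close> on a middle piece of
    length \<open>3*w\<close>; hence its integral is at least \<open>3 * w * w\<close> and it can be
    normalised.\<close>
  define w where "w = (b - a) / 9"
  have w: "w > 0" using ab by (simp add: w_def)
  have bw: "b = a + 9 * w" by (simp add: w_def field_simps)
  define \<rho>0 where "\<rho>0 x = max 0 (min (x - (a + 2*w)) (b - 2*w - x))" for x
  have \<rho>0_cont: "continuous_on S \<rho>0" for S unfolding \<rho>0_def by (intro continuous_intros)
  have \<rho>0_supp: "\<rho>0 x = 0" if "x \<notin> {a + 2*w..b - 2*w}" for x using that by (auto simp: \<rho>0_def)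
  have intU: "f integrable_on UNIV" if "continuous_on UNIV f" "\<And>x. x \<notin> {p..q} \<Longrightarrow> f x = 0"
    for f :: "real \<Rightarrow> real" and p q
    by (rule integrable_on_superset[of _ "{p..q}"])
      (use that in \<open>auto intro: integrable_continuous_real continuous_on_subset\<close>)
  have "3 * w * w = integral {a + 3*w..b - 3*w} (\<lambda>x. w)"
    using w by (simp add: bw)
  also have "\<dots> \<le> integral {a + 3*w..b - 3*w} \<rho>0"
    by (rule integral_le) (use \<rho>0_cont in \<open>auto intro!: integrable_continuous_real simp: \<rho>0_def\<close>)
  also have "\<dots> \<le> integral UNIV \<rho>0"
  proof (rule integral_subset_le)
    show "\<rho>0 integrable_on UNIV" by (rule intU[OF \<rho>0_cont \<rho>0_supp])
    show "\<rho>0 integrable_on {a + 3*w..b - 3*w}" by (intro integrable_continuous_real \<rho>0_cont)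
  qed (auto simp: \<rho>0_def)
  finally have c: "integral UNIV \<rho>0 > 0"
    using w by (smt (verit) mult_pos_pos)
  define \<rho> where "\<rho> x = inverse (integral UNIV \<rho>0) * \<rho>0 x" for x
  have \<rho>_cont: "continuous_on UNIV \<rho>"
    using c unfolding \<rho>_def by (auto intro!: continuous_intros \<rho>0_cont)
  have \<rho>_supp: "\<rho> x = 0" if "x \<notin> {a + 2*w..b - 2*w}" for x
    using \<rho>0_supp[OF that] by (simp add: \<rho>_def)
  have \<rho>_nn: "0 \<le> \<rho> x" for x using c by (simp add: \<rho>_def \<rho>0_def)
  have \<rho>_int: "integral UNIV \<rho> = 1" 
  proof -
    have "\<rho> = (\<lambda>x. inverse (integral UNIV \<rho>0) * \<rho>0 x)" by (simp add: \<rho>_def fun_eq_iff)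
    then show ?thesis using c by simp
  qed
  have one: "integrable ?M (\<lambda>x. 1::real)"
    by (rule finite_measure.integrable_const) (simp add: finite_measure_lebesgue_on)
  define g where "g = (LINT x|?M. \<rho> x * G x)"
  \<comment> \<open>With \<open>m\<close> the mass of \<open>\<phi>\<close>, the density
    \<open>\<kappa> = \<phi> - m \<rho>\<close> has mean zero and L1 norm at most
    \<open>2 * m\<close>. The weak identity for its antiderivative \<open>\<psi>\<close> equates the
    integral of \<open>\<phi> G\<close> minus \<open>m * g\<close> with that of
    \<open>\<psi> v\<close>, and the latter is at most \<open>2 * m * M * (b - a)\<close> in
    absolute value.\<close>
  have key: "\<bar>(LINT x|?M. \<phi> x * G x) - (LINT x|?M. \<phi> x) * g\<bar> \<le> 2 * M * (b - a) * (LINT x|?M. \<phi> x)"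
    and pG: "integrable ?M (\<lambda>x. \<phi> x * G x)" and p1: "integrable ?M \<phi>"
    if phi: "continuous_on UNIV \<phi>" "\<And>x. 0 \<le> \<phi> x" "a < p" "q < b"
        "\<And>x. x \<notin> {p..q} \<Longrightarrow> \<phi> x = 0" for \<phi> p q
  proof -
    show pG: "integrable ?M (\<lambda>x. \<phi> x * G x)"
      by (rule integrable_continuous_mult[OF phi(1,5) G]) auto
    show p1: "integrable ?M \<phi>"
      using integrable_continuous_mult[OF phi(1,5) one] by simp
    define m where "m = integral UNIV \<phi>"
    have m0: "m \<ge> 0" unfolding m_def
      by (rule integral_nonneg) (use phi(2) intU[OF phi(1,5)] in simp_all)
    have "integral\<^sup>L ?M \<phi> = integral ?K \<phi>"
      by (rule lebesgue_integral_eq_integral[OF p1]) auto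
    also have "\<dots> = m" unfolding m_def
      by (rule integral_spike_set; rule negligible_subset[of "{}"]) (use phi in fastforce)+
    finally have m: "integral\<^sup>L ?M \<phi> = m" .
    define \<kappa> where "\<kappa> x = \<phi> x - m * \<rho> x" for x
    define p' where "p' = min p (a + 2*w)"
    define q' where "q' = max q (b - 2*w)"
    have pq': "a < p'" "q' < b" using phi w by (auto simp: p'_def q'_def)
    have "\<phi> x = 0" "\<rho> x = 0" if "x \<notin> {p'..q'}" for x
      using that by (auto intro!: phi(5) \<rho>_supp simp: p'_def q'_def)
    then have \<kappa>: "continuous_on UNIV \<kappa>" "\<And>x. x \<notin> {p'..q'} \<Longrightarrow> \<kappa> x = 0"
      unfolding \<kappa>_def by (auto intro!: continuous_intros \<rho>_cont phi(1))
    have iphi: "\<phi> integrable_on UNIV" by (rule intU[OF phi(1,5)])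
    have irho: "\<rho> integrable_on UNIV" by (rule intU[OF \<rho>_cont \<rho>_supp])
    have imrho: "(\<lambda>x. m * \<rho> x) integrable_on UNIV"
      using integrable_on_mult_right[OF irho] .
    have "\<kappa> = (\<lambda>x. \<phi> x - m * \<rho> x)" by (simp add: \<kappa>_def fun_eq_iff)
    then have "integral UNIV \<kappa> = integral UNIV \<phi> - integral UNIV (\<lambda>x. m * \<rho> x)"
      using integral_diff[OF iphi imrho] by simp
    then have mean: "integral UNIV \<kappa> = 0"
      by (simp add: \<rho>_int m_def)
    have "integral UNIV (\<lambda>x. \<bar>\<kappa> x\<bar>) \<le> integral UNIV (\<lambda>x. \<phi> x + m * \<rho> x)"
    proof (rule integral_le)
      show "(\<lambda>x. \<bar>\<kappa> x\<bar>) integrable_on UNIV"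
        by (rule intU[of _ p' q']) (use \<kappa> in \<open>auto intro: continuous_intros\<close>)
      show "(\<lambda>x. \<phi> x + m * \<rho> x) integrable_on UNIV"
        by (intro integrable_add iphi imrho)
      fix x show "\<bar>\<kappa> x\<bar> \<le> \<phi> x + m * \<rho> x"
        using phi(2)[of x] mult_nonneg_nonneg[OF m0 \<rho>_nn[of x]] by (auto simp: \<kappa>_def)
    qed
    also have "\<dots> = integral UNIV \<phi> + integral UNIV (\<lambda>x. m * \<rho> x)"
      by (rule integral_add[OF iphi imrho])
    also have "\<dots> = 2 * m" by (simp add: \<rho>_int m_def)
    finally have abs: "integral UNIV (\<lambda>x. \<bar>\<kappa> x\<bar>) \<le> 2 * m" .
    obtain \<psi> where \<psi>: "\<And>x. (\<psi> has_vector_derivative \<kappa> x) (at x)"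
      "\<And>x. x \<notin> {p'..q'} \<Longrightarrow> \<psi> x = 0" "\<And>x. \<bar>\<psi> x\<bar> \<le> integral UNIV (\<lambda>x. \<bar>\<kappa> x\<bar>)"
      using zero_mean_test_function[OF \<kappa> mean] by blast
    have \<psi>_le: "\<bar>\<psi> x\<bar> \<le> 2 * m" for x using \<psi>(3)[of x] abs by linarith
    have "continuous_on UNIV \<psi>"
      using \<psi>(1) by (meson continuous_at_imp_continuous_on has_vector_derivative_continuous)
    then have iv: "integrable ?M (\<lambda>x. \<psi> x * v x)"
      by (rule integrable_continuous_mult[OF _ \<psi>(2) v]) auto
    have iG: "integrable ?M (\<lambda>x. \<kappa> x * G x)"
      by (rule integrable_continuous_mult[OF \<kappa> G]) auto
    have irG: "integrable ?M (\<lambda>x. \<rho> x * G x)"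
      by (rule integrable_continuous_mult[OF \<rho>_cont \<rho>_supp G]) auto
    have "(LINT x|?M. \<kappa> x * G x) - (LINT x|?M. \<psi> x * v x) = 0"
      using weak[OF \<psi>(1) \<kappa>(1) pq' \<psi>(2) \<kappa>(2)] iv iG by simp
    moreover have "(LINT x|?M. \<kappa> x * G x) = (LINT x|?M. \<phi> x * G x - m * (\<rho> x * G x))"
      by (simp add: \<kappa>_def algebra_simps)
    moreover have "\<dots> = (LINT x|?M. \<phi> x * G x) - m * g"
      using pG irG by (simp add: g_def)
    moreover have "\<bar>LINT x|?M. \<psi> x * v x\<bar> \<le> 2 * M * (b - a) * m"
    proof -
      have "\<bar>LINT x|?M. \<psi> x * v x\<bar> \<le> (LINT x|?M. \<bar>\<psi> x * v x\<bar>)"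
        by (rule integral_abs_bound)
      also have "\<dots> \<le> (LINT x|?M. 2 * m * M * 1)"
      proof (rule integral_mono_AE)
        show "integrable ?M (\<lambda>x. 2 * m * M * 1)" using one by (rule integrable_mult_right)
        show "AE x in ?M. \<bar>\<psi> x * v x\<bar> \<le> 2 * m * M * 1"
          using vM
        proof eventually_elim
          case (elim x)
          then show ?case
            using mult_mono[OF \<psi>_le[of x] elim] m0 by (simp add: abs_mult)
        qed
      qed (use iv in simp)
      also have "\<dots> = 2 * m * M * (b - a)"
        using ab by (simp add: measure_restrict_space)
      finally show ?thesis by (simp add: mult_ac)
    qed
    ultimately show "\<bar>(LINT x|?M. \<phi> x * G x) - (LINT x|?M. \<phi> x) * g\<bar> \<le> 2 * M * (b - a) * (LINT x|?M. \<phi> x)"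
      by (simp add: m)
  qed
  \<comment> \<open>The two signs \<open>s\<close> give the two halves of the absolute value; for
    each, \<open>key\<close> is exactly the tested inequality that the fundamental lemma asks
    for.\<close>
  have "AE x in ?M. s * (G x - g) - 2 * M * (b - a) \<le> 0" if s: "s = 1 \<or> s = -1" for s
  proof (rule AE_nonpos_if_integral_nonpos)
    show "integrable ?M (\<lambda>x. s * (G x - g) - 2 * M * (b - a))"
      using G one by (simp add: finite_measure.integrable_const finite_measure_lebesgue_on)
    fix \<phi> p q
    assume phi: "continuous_on UNIV \<phi>" "\<And>x. 0 \<le> \<phi> x" "a < p" "q < b"
      "\<And>x. x \<notin> {p..q} \<Longrightarrow> \<phi> x = (0::real)"
    have "(LINT x|?M. \<phi> x * (s * (G x - g) - 2 * M * (b - a))) =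
        (LINT x|?M. s * (\<phi> x * G x) - (s * g + 2 * M * (b - a)) * \<phi> x)"
      by (rule Bochner_Integration.integral_cong) (auto simp: algebra_simps)
    also have "\<dots> = s * (LINT x|?M. \<phi> x * G x) - (s * g + 2 * M * (b - a)) * (LINT x|?M. \<phi> x)"
      using pG[OF phi] p1[OF phi] by simp
    also have "\<dots> \<le> 0"
      using s key[OF phi] by (auto simp: algebra_simps abs_le_iff)
    finally show "(LINT x|?M. \<phi> x * (s * (G x - g) - 2 * M * (b - a))) \<le> 0" .
  qed
  from this[of 1] this[of "-1"] have "AE x in ?M. \<bar>G x - g\<bar> \<le> 2 * M * (b - a)"
    by (auto elim: AE_mp)
  then show ?thesis by (rule that)
qed

text \<open>Testing with \<open>\<psi>\<close> times a basis vector reduces to the scalar case. The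
  factor \<open>DIM('a)\<close> arises because a norm is at most the sum of the absolute
  coordinates.\<close>

lemma weak_derivative_oscillation_bound:
  fixes G v :: "real \<Rightarrow> 'a::euclidean_space" and a b M :: real
  assumes ab: "a < b" and M: "0 \<le> M"
    and G: "integrable (lebesgue_on {a<..<b}) G" and v: "integrable (lebesgue_on {a<..<b}) v"
    and vM: "AE x in lebesgue_on {a<..<b}. norm (v x) \<le> M"
    and weak: "\<And>\<psi> \<phi> p q. \<lbrakk>\<And>x. (\<psi> has_vector_derivative \<phi> x) (at x); continuous_on UNIV \<phi>;
       a < p; q < b; \<And>x. x \<notin> {p..q} \<Longrightarrow> \<psi> x = 0; \<And>x. x \<notin> {p..q} \<Longrightarrow> \<phi> x = 0\<rbrakk>
       \<Longrightarrow> (LINT x|lebesgue_on {a<..<b}. \<phi> x \<bullet> G x - \<psi> x \<bullet> v x) = 0"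
  obtains g where "AE x in lebesgue_on {a<..<b}. norm (G x - g) \<le> DIM('a) * (2 * M * (b - a))"
proof -
  let ?M = "lebesgue_on {a<..<b}"
  have "\<exists>g. AE x in ?M. \<bar>G x \<bullet> e - g\<bar> \<le> 2 * M * (b - a)" if e: "e \<in> Basis" for e
  proof (rule weak_derivative_oscillation_bound_real[OF ab M, of "\<lambda>x. G x \<bullet> e" "\<lambda>x. v x \<bullet> e"])
    show "integrable ?M (\<lambda>x. G x \<bullet> e)" "integrable ?M (\<lambda>x. v x \<bullet> e)"
      using G v by auto
    show "AE x in ?M. \<bar>v x \<bullet> e\<bar> \<le> M"
      using vM by eventually_elim (use e in \<open>force intro: order_trans[OF Basis_le_norm]\<close>)
    fix \<psi> \<phi> :: "real \<Rightarrow> real" and p q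
    assume a: "\<And>x. (\<psi> has_vector_derivative \<phi> x) (at x)" "continuous_on UNIV \<phi>"
       "a < p" "q < b" "\<And>x. x \<notin> {p..q} \<Longrightarrow> \<psi> x = 0" "\<And>x. x \<notin> {p..q} \<Longrightarrow> \<phi> x = 0"
    have "(LINT x|?M. (\<phi> x *\<^sub>R e) \<bullet> G x - (\<psi> x *\<^sub>R e) \<bullet> v x) = 0"
    proof (rule weak[where p = p and q = q])
      show "((\<lambda>x. \<psi> x *\<^sub>R e) has_vector_derivative \<phi> x *\<^sub>R e) (at x)" for x
        using has_vector_derivative_scaleR[of \<psi> "\<phi> x" x UNIV "\<lambda>_. e" 0] a(1)[of x]
        by (auto simp: has_real_derivative_iff_has_vector_derivative)
      show "continuous_on UNIV (\<lambda>x. \<phi> x *\<^sub>R e)" by (intro continuous_intros a)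
    qed (use a in auto)
    then show "(LINT x|?M. \<phi> x * (G x \<bullet> e) - \<psi> x * (v x \<bullet> e)) = 0"
      by (simp add: inner_commute)
  qed blast
  then obtain g where g: "\<And>e. e \<in> Basis \<Longrightarrow> AE x in ?M. \<bar>G x \<bullet> e - g e\<bar> \<le> 2 * M * (b - a)"
    by metis
  have "AE x in ?M. \<forall>e\<in>Basis. \<bar>G x \<bullet> e - g e\<bar> \<le> 2 * M * (b - a)"
    by (rule AE_finite_allI) (auto intro: g)
  then have "AE x in ?M. norm (G x - (\<Sum>e\<in>Basis. g e *\<^sub>R e)) \<le> DIM('a) * (2 * M * (b - a))"
  proof eventually_elim
    case (elim x)
    have "norm (G x - (\<Sum>e\<in>Basis. g e *\<^sub>R e))
        \<le> (\<Sum>e\<in>Basis. \<bar>(G x - (\<Sum>e\<in>Basis. g e *\<^sub>R e)) \<bullet> e\<bar>)"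
      by (rule norm_le_l1)
    also have "\<dots> \<le> (\<Sum>e\<in>(Basis :: 'a set). 2 * M * (b - a))"
      by (rule sum_mono) (use elim in \<open>simp add: inner_diff_left\<close>)
    finally show ?case by simp
  qed
  then show ?thesis by (rule that)
qed

section \<open>Essential images at a point\<close>

text \<open>Each point of \<open>C\<close> has a neighbourhood that \<open>v\<close> avoids almost
  everywhere close to \<open>\<xi>\<close>; finitely many of them cover \<open>C\<close>, and the
  least radius serves for all. This both confines \<open>v\<close> to a ball near a continuity point
  and shows that essential images at a point are nonempty.\<close>

lemma AE_notin_compact:
  fixes v :: "real \<Rightarrow> 'a::topological_space"
  assumes v: "v \<in> borel_measurable lebesgue" and C: "compact C" and "C \<inter> ess_im_at v \<xi> = {}"
  obtains r where "r > 0" "AE s in lebesgue. s \<in> {\<xi> - r<..<\<xi> + r} \<longrightarrow> v s \<notin> C"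
proof -
  have "\<exists>r V. 0 < r \<and> open V \<and> u \<in> V \<and> emeasure lebesgue (v -` V \<inter> {\<xi> - r<..<\<xi> + r}) = 0"
    if "u \<in> C" for u
  proof -
    have "u \<notin> ess_im_at v \<xi>" using assms(3) that by blast
    then obtain r where "0 < r" "u \<notin> ess_im v {\<xi> - r<..<\<xi> + r}"
      unfolding ess_im_at_def by blast
    then show ?thesis unfolding ess_im_def not_gr_zero[symmetric] by blast
  qed
  then obtain r V where rV: "\<And>u. u \<in> C \<Longrightarrow> 0 < r u" "\<And>u. u \<in> C \<Longrightarrow> open (V u)"
    "\<And>u. u \<in> C \<Longrightarrow> u \<in> V u"
    "\<And>u. u \<in> C \<Longrightarrow> emeasure lebesgue (v -` V u \<inter> {\<xi> - r u<..<\<xi> + r u}) = 0"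
    by metis
  have "C \<subseteq> (\<Union>u\<in>C. V u)" using rV(3) by auto
  then obtain D where D: "D \<subseteq> C" "finite D" "C \<subseteq> (\<Union>u\<in>D. V u)"
    using compactE_image[OF C, of C V] rV(2) by auto
  \<comment> \<open>The extra 1 keeps the minimum meaningful when \<open>D\<close> is empty.\<close>
  define R where "R = Min (insert 1 (r ` D))"
  have "R > 0" unfolding R_def using D rV(1) by (subst Min_gr_iff) auto
  have R: "R \<le> r u" if "u \<in> D" for u unfolding R_def using D that by auto
  have "AE s in lebesgue. s \<notin> v -` V u \<inter> {\<xi> - r u<..<\<xi> + r u}" if "u \<in> D" for u
  proof (rule AE_not_in)
    have u: "u \<in> C" using D that by auto
    have "v -` V u \<in> sets lebesgue"
      using measurable_sets[OF v, of "V u"] rV(2)[OF u] by simp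
    then show "v -` V u \<inter> {\<xi> - r u<..<\<xi> + r u} \<in> null_sets lebesgue"
      using rV(4)[OF u] by (auto simp: null_sets_def)
  qed
  then have "AE s in lebesgue. \<forall>u\<in>D. s \<notin> v -` V u \<inter> {\<xi> - r u<..<\<xi> + r u}"
    using D by (intro AE_finite_allI) auto
  then have "AE s in lebesgue. s \<in> {\<xi> - R<..<\<xi> + R} \<longrightarrow> v s \<notin> C"
  proof eventually_elim
    case (elim s)
    show ?case
    proof (intro impI notI)
      assume "s \<in> {\<xi> - R<..<\<xi> + R}" "v s \<in> C"
      then obtain u where "u \<in> D" "v s \<in> V u" using D by auto
      with elim R[of u] \<open>s \<in> _\<close> show False by auto
    qed
  qed
  with \<open>R > 0\<close> show ?thesis by (rule that)
qed

text \<open>A set of positive measure meets every set of full measure. This carries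
  almost-everywhere estimates over to the points of the essential image.\<close>

lemma ess_im_at_witness:
  assumes "v \<in> borel_measurable lebesgue" and u: "u \<in> ess_im_at v \<xi>" "open V" "u \<in> V" "0 < r"
    and P: "AE s in lebesgue. s \<in> {\<xi> - r<..<\<xi> + r} \<longrightarrow> P s"
  obtains s where "s \<in> {\<xi> - r<..<\<xi> + r}" "v s \<in> V" "P s"
proof -
  let ?A = "v -` V \<inter> {\<xi> - r<..<\<xi> + r}"
  have pos: "emeasure lebesgue ?A > 0"
    using u by (auto simp: ess_im_at_def ess_im_def)
  have "v -` V \<in> sets lebesgue"
    using measurable_sets[OF assms(1), of V] u by simp
  then have A: "?A \<in> sets lebesgue" by auto
  have "\<exists>s\<in>?A. P s"
  proof (rule ccontr)
    assume "\<not> (\<exists>s\<in>?A. P s)"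
    then have "AE s in lebesgue. s \<notin> ?A"
      using P by (auto elim!: eventually_mono)
    then have "?A \<in> null_sets lebesgue" using A by (simp add: AE_iff_null_sets)
    then show False using pos by auto
  qed
  then show ?thesis using that by auto
qed

section \<open>Injectivity of the shifted flux near a non-resonant state\<close>

lemma C2_on_imp_continuous_on: "C2_on f U \<Longrightarrow> continuous_on U f"
  unfolding C2_on_def
  by (meson continuous_at_imp_continuous_on has_derivative_continuous)

text \<open>An injective linear map is bounded below by some \<open>B > 0\<close>. Moving the state
  and moving \<open>\<xi>\<close> each cost at most \<open>B / 4\<close>, so the lower bound
  survives as \<open>B / 2\<close>, uniformly on one ball and for all \<open>\<xi>\<close> close to
  \<open>\<xi>0\<close>. The same budget serves the determinant and the injectivity of the nonlinear
  map.\<close>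

lemma C2_on_shifted_injective:
  fixes f :: "real^'n \<Rightarrow> real^'n"
  assumes U: "open U" and f: "C2_on f U" and u0: "u0 \<in> U"
    and det0: "det (- \<xi>0 *\<^sub>R mat 1 + jacobian f (at u0)) \<noteq> 0"
  shows "\<exists>\<epsilon>>0. cball u0 \<epsilon> \<subseteq> U \<and>
    (\<forall>\<xi>. \<bar>\<xi> - \<xi>0\<bar> < \<epsilon> \<longrightarrow>
      (\<forall>u\<in>cball u0 \<epsilon>. det (- \<xi> *\<^sub>R mat 1 + jacobian f (at u)) \<noteq> 0) \<and>
      inj_on (\<lambda>u. f u - \<xi> *\<^sub>R u) (cball u0 \<epsilon>))"
proof -
  obtain f' :: "real^'n \<Rightarrow> (real^'n) \<Rightarrow>\<^sub>L (real^'n)"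
    where f': "\<And>x. x \<in> U \<Longrightarrow> (f has_derivative blinfun_apply (f' x)) (at x)" and C1: "C1_on f' U"
    using f unfolding C2_on_def by blast
  have cf': "continuous_on U f'"
    using C1 unfolding C1_on_def
    by (meson continuous_at_imp_continuous_on has_derivative_continuous)
  \<comment> \<open>Non-resonance is restated through \<open>f'\<close>, whose continuity in
    operator norm controls the perturbation.\<close>
  have jac: "(- \<xi> *\<^sub>R mat 1 + jacobian f (at u)) *v x = f' u x - \<xi> *\<^sub>R x" if "u \<in> U" for \<xi> u x
  proof -
    have "jacobian f (at u) *v x = f' u x"
      using frechet_derivative_at[OF f'[OF that]] 
        fun_cong[OF matrix_vector_mul(3)[OF blinfun.bounded_linear_right], of "f' u" x]
      by (simp add: jacobian_def)
    then show ?thesis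
      by (simp add: matrix_vector_mult_diff_rdistrib scaleR_matrix_vector_assoc[symmetric])
  qed
  have det_iff: "det (- \<xi> *\<^sub>R mat 1 + jacobian f (at u)) \<noteq> 0 \<longleftrightarrow> inj (\<lambda>x. f' u x - \<xi> *\<^sub>R x)"
    if "u \<in> U" for \<xi> u
  proof -
    let ?A = "- \<xi> *\<^sub>R mat 1 + jacobian f (at u)"
    have "det ?A \<noteq> 0 \<longleftrightarrow> inj ((*v) ?A)"
      using det_nz_iff_inj[OF matrix_vector_mul_linear[of ?A]]
      by (simp only: matrix_of_matrix_vector_mul)
    moreover have "(*v) ?A = (\<lambda>x. f' u x - \<xi> *\<^sub>R x)"
      using jac[OF that] by (rule ext)
    ultimately show ?thesis by (simp only:)
  qed
  have lin: "linear (\<lambda>x. f' u x - \<xi> *\<^sub>R x)" for u \<xi>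
    by (intro linear_compose_sub bounded_linear.linear blinfun.bounded_linear_right bounded_linear_scaleR_right)
  obtain B where B: "B > 0" "\<And>x. B * norm x \<le> norm (f' u0 x - \<xi>0 *\<^sub>R x)"
    using linear_inj_bounded_below_pos[OF lin det_iff[OF u0, THEN iffD1, OF det0]] by blast
  obtain d where d: "d > 0" "\<And>u. \<lbrakk>u \<in> U; dist u u0 < d\<rbrakk> \<Longrightarrow> dist (f' u) (f' u0) < B / 4"
    using cf'[unfolded continuous_on_iff, rule_format, OF u0, of "B / 4"] B(1) by auto
  obtain e where e: "e > 0" "cball u0 e \<subseteq> U"
    using U u0 open_contains_cball by blast
  \<comment> \<open>Half of \<open>d\<close> puts even the boundary of the closed ball strictly
    within distance \<open>d\<close>; \<open>B / 4\<close> bounds the cost of replacing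
    \<open>\<xi>0\<close> by \<open>\<xi>\<close>.\<close>
  define \<epsilon> where "\<epsilon> = min (min (d / 2) e) (B / 4)"
  have eps: "\<epsilon> > 0" "\<epsilon> < d" "\<epsilon> \<le> e" "\<epsilon> \<le> B / 4"
    using d e B by (auto simp: \<epsilon>_def)
  have sub: "cball u0 \<epsilon> \<subseteq> U" using e eps by force
  have near: "norm (f' u x - f' u0 x) \<le> B / 4 * norm x" if "u \<in> cball u0 \<epsilon>" for u x
  proof -
    have "norm (f' u - f' u0) \<le> B / 4"
      using d(2)[of u] that sub eps by (force simp: dist_norm norm_minus_commute)
    then show ?thesis
      using norm_blinfun[of "f' u - f' u0" x] mult_right_mono[of "norm (f' u - f' u0)" "B/4" "norm x"]
      by (simp add: blinfun.diff_left)
  qed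
  have shift: "norm ((\<xi> - \<xi>0) *\<^sub>R x) \<le> B / 4 * norm x" if "\<bar>\<xi> - \<xi>0\<bar> < \<epsilon>" for \<xi> and x :: "real^'n"
    unfolding norm_scaleR by (rule mult_right_mono) (use that eps in auto)
  show ?thesis
  proof (intro exI[of _ \<epsilon>] conjI eps(1) sub allI impI ballI)
    fix \<xi> u assume \<xi>: "\<bar>\<xi> - \<xi>0\<bar> < \<epsilon>" and u: "u \<in> cball u0 \<epsilon>"
    have "inj (\<lambda>x. f' u x - \<xi> *\<^sub>R x)"
    proof (subst linear_injective_0[OF lin], intro allI impI)
      fix x assume x: "f' u x - \<xi> *\<^sub>R x = 0"
      have eq0: "f' u0 x - \<xi>0 *\<^sub>R x = (\<xi> - \<xi>0) *\<^sub>R x - (f' u x - f' u0 x)"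
        using x by (simp add: algebra_simps)
      have "B * norm x \<le> B / 4 * norm x + B / 4 * norm x"
        using B(2)[of x, unfolded eq0] near[OF u, of x] shift[OF \<xi>, of x]
          norm_triangle_ineq4[of "(\<xi> - \<xi>0) *\<^sub>R x" "f' u x - f' u0 x"] by linarith
      then show "x = 0" using B(1) by (simp add: field_simps)
    qed
    then show "det (- \<xi> *\<^sub>R mat 1 + jacobian f (at u)) \<noteq> 0"
      using det_iff[of u] u sub by blast
  next
    fix \<xi> assume \<xi>: "\<bar>\<xi> - \<xi>0\<bar> < \<epsilon>"
    show "inj_on (\<lambda>u. f u - \<xi> *\<^sub>R u) (cball u0 \<epsilon>)"
    proof (rule inj_onI)
      fix u w assume u: "u \<in> cball u0 \<epsilon>" and w: "w \<in> cball u0 \<epsilon>"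
        and eq: "f u - \<xi> *\<^sub>R u = f w - \<xi> *\<^sub>R w"
      \<comment> \<open>Mean value inequality for \<open>f\<close> minus its linear part at
        \<open>u0\<close>. Equality of the shifted fluxes then writes the map bounded below, applied
        to \<open>u - w\<close>, as a difference of two terms of size at most \<open>B / 4\<close>
        times the norm of \<open>u - w\<close>.\<close>
      have "norm ((f u - f' u0 u) - (f w - f' u0 w)) \<le> B / 4 * norm (u - w)"
      proof (rule differentiable_bound[OF convex_cball _ _ u w])
        fix z assume z: "z \<in> cball u0 \<epsilon>"
        show "((\<lambda>z. f z - f' u0 z) has_derivative (\<lambda>x. f' z x - f' u0 x)) (at z within cball u0 \<epsilon>)"
          using z sub by (intro has_derivative_diff has_derivative_at_withinI[OF f']
            bounded_linear_imp_has_derivative blinfun.bounded_linear_right) auto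
        show "onorm (\<lambda>x. f' z x - f' u0 x) \<le> B / 4"
          by (rule onorm_le) (use near[OF z] in auto)
      qed
      moreover have eq0: "f' u0 (u - w) - \<xi>0 *\<^sub>R (u - w)
          = (\<xi> - \<xi>0) *\<^sub>R (u - w) - ((f u - f' u0 u) - (f w - f' u0 w))"
        using eq by (simp add: blinfun.diff_right algebra_simps)
      ultimately have "B * norm (u - w) \<le> B / 4 * norm (u - w) + B / 4 * norm (u - w)"
        using B(2)[of "u - w", unfolded eq0] shift[OF \<xi>, of "u - w"]
          norm_triangle_ineq4[of "(\<xi> - \<xi>0) *\<^sub>R (u - w)" "(f u - f' u0 u) - (f w - f' u0 w)"]
        by linarith
      then show "u = w" using B(1) by (simp add: field_simps)
    qed
  qed
qed

section \<open>Openness of the set of non-resonant points\<close>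

lemma test_function_compact_support:
  fixes \<psi> :: "real \<Rightarrow> 'a::real_normed_vector"
  assumes "\<And>x. (\<psi> has_vector_derivative \<phi> x) (at x)" "continuous_on UNIV \<phi>"
    and "\<And>x. x \<notin> {p..q} \<Longrightarrow> \<psi> x = 0"
  shows "C1c \<psi>"
proof -
  have "closure {x. \<psi> x \<noteq> 0} \<subseteq> {p..q}"
    by (intro closure_minimal subsetI) (use assms(3) in blast)+
  then have "compact (closure {x. \<psi> x \<noteq> 0})"
    by (meson bounded_subset closed_closure compact_eq_bounded_closed compact_Icc)
  then show ?thesis
    using assms unfolding C1c_def C1_differentiable_on_def by blast
qed

lemma open_nonresonant_set:
  fixes U :: "(real^'n) set"
    and f :: "real^'n \<Rightarrow> real^'n"
    and v :: "real \<Rightarrow> real^'n"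
  assumes U: "open U" and f: "C2_on f U" and sol: "self_similar_weak_solution f U v"
  shows "open (nonresonant_set f v)"
proof -
  have vm: "v \<in> borel_measurable lebesgue"
    and "\<exists>B. AE s in lebesgue. norm (v s) \<le> B"
    and imv: "ess_im v UNIV \<subseteq> U"
    and weak: "\<And>\<psi>. C1c \<psi> \<Longrightarrow> has_bochner_integral lebesgue
          (\<lambda>s. vector_derivative \<psi> (at s) \<bullet> (- s *\<^sub>R v s + f (v s)) - \<psi> s \<bullet> v s) 0"
    using sol by (auto simp: self_similar_weak_solution_def L_infinity_def strictly_hyperbolic_set_def)
  then obtain B where vB: "AE s in lebesgue. norm (v s) \<le> B" by blast
  have "\<exists>e>0. ball \<xi>0 e \<subseteq> nonresonant_set f v" if \<xi>0: "\<xi>0 \<in> nonresonant_set f v" for \<xi>0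
  proof -
    obtain u0 where u0: "ess_im_at v \<xi>0 = {u0}"
      and det0: "det (- \<xi>0 *\<^sub>R mat 1 + jacobian f (at u0)) \<noteq> 0"
      using \<xi>0 by (auto simp: nonresonant_set_def ess_im_continuity_point_def ess_im_value_def
          elim!: is_singletonE)
    have "ess_im_at v \<xi>0 \<subseteq> ess_im v {\<xi>0 - 1<..<\<xi>0 + 1}" unfolding ess_im_at_def by force
    also have "\<dots> \<subseteq> ess_im v UNIV"
    proof
      fix u assume u: "u \<in> ess_im v {\<xi>0 - 1<..<\<xi>0 + 1}"
      show "u \<in> ess_im v UNIV" unfolding ess_im_def
      proof (intro CollectI allI impI)
        fix V assume V: "open V \<and> u \<in> V"
        have "0 < emeasure lebesgue (v -` V \<inter> {\<xi>0 - 1<..<\<xi>0 + 1})"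
          using u V by (auto simp: ess_im_def)
        also have "\<dots> \<le> emeasure lebesgue (v -` V \<inter> UNIV)"
          using measurable_sets[OF vm, of V] V by (intro emeasure_mono) auto
        finally show "0 < emeasure lebesgue (v -` V \<inter> UNIV)" .
      qed
    qed
    finally have u0U: "u0 \<in> U" using imv u0 by auto
    obtain \<epsilon> where \<epsilon>: "\<epsilon> > 0" "cball u0 \<epsilon> \<subseteq> U"
      and det: "\<And>\<xi> u. \<lbrakk>\<bar>\<xi> - \<xi>0\<bar> < \<epsilon>; u \<in> cball u0 \<epsilon>\<rbrakk>
        \<Longrightarrow> det (- \<xi> *\<^sub>R mat 1 + jacobian f (at u)) \<noteq> 0"
      and inj: "\<And>\<xi>. \<bar>\<xi> - \<xi>0\<bar> < \<epsilon> \<Longrightarrow> inj_on (\<lambda>u. f u - \<xi> *\<^sub>R u) (cball u0 \<epsilon>)"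
      using C2_on_shifted_injective[OF U f u0U det0] by blast
    note cf = C2_on_imp_continuous_on[OF f]
    define C where "C = cball u0 \<epsilon>"
    have C: "compact C" "closed C" "C \<in> sets borel" "C \<subseteq> U" using \<epsilon> by (auto simp: C_def)
    \<comment> \<open>Essential boundedness leaves only a compact set of values outside the open
      ball. It misses \<open>u0\<close>, the sole essential value at \<open>\<xi>0\<close>, so
      \<open>v\<close> stays in \<open>C\<close> almost everywhere near
      \<open>\<xi>0\<close>.\<close>
    have "compact (cball 0 B - ball u0 \<epsilon>)" by (intro compact_diff) auto
    moreover have "(cball 0 B - ball u0 \<epsilon>) \<inter> ess_im_at v \<xi>0 = {}" using u0 \<epsilon> by auto
    ultimately obtain r0 where r0: "r0 > 0"
      "AE s in lebesgue. s \<in> {\<xi>0 - r0<..<\<xi>0 + r0} \<longrightarrow> v s \<notin> cball 0 B - ball u0 \<epsilon>"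
      by (rule AE_notin_compact[OF vm])
    have vC: "AE s in lebesgue. s \<in> {\<xi>0 - r0<..<\<xi>0 + r0} \<longrightarrow> v s \<in> C"
      using r0(2) vB by eventually_elim (auto simp: C_def)
    define e where "e = min r0 \<epsilon>"
    have e: "e > 0" "e \<le> r0" "e \<le> \<epsilon>" using r0 \<epsilon> by (auto simp: e_def)
    define M where "M = norm u0 + \<epsilon>"
    have M: "0 \<le> M" using \<epsilon> by (simp add: M_def)
    have CM: "norm w \<le> M" if "w \<in> C" for w
      using that norm_triangle_ineq2[of w u0] by (auto simp: C_def M_def dist_norm norm_minus_commute)
    have "compact (f ` C)" using C cf by (intro compact_continuous_image) (auto intro: continuous_on_subset)
    then obtain F where F: "\<And>w. w \<in> C \<Longrightarrow> norm (f w) \<le> F"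
      using compact_imp_bounded bounded_iff by (metis imageI)
    \<comment> \<open>Outside \<open>U\<close> the function \<open>f\<close> is arbitrary and
      \<open>f (v s)\<close> might not be measurable. The indicator of \<open>C\<close> restores
      measurability and changes nothing almost everywhere near \<open>\<xi>0\<close>.\<close>
    define G where "G s = indicator C (v s) *\<^sub>R f (v s) - s *\<^sub>R v s" for s
    have "(\<lambda>u. indicator C u *\<^sub>R f u) \<in> borel_measurable borel"
      using C cf by (intro borel_measurable_continuous_on_indicator) (auto intro: continuous_on_subset)
    from measurable_compose[OF vm this] have Gm: "G \<in> borel_measurable lebesgue"
      unfolding G_def
      by (rule borel_measurable_diff)
        (intro borel_measurable_scaleR vm id_borel_measurable_lebesgue[unfolded id_def])
    \<comment> \<open>The factor in front of \<open>r\<close> is independent of the centre and the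
      radius, since \<open>M\<close> bounds all of \<open>C\<close>.\<close>
    have osc: "\<exists>g. AE s in lebesgue. s \<in> {\<xi> - r<..<\<xi> + r} \<longrightarrow>
        norm (G s - g) \<le> DIM(real^'n) * (2 * M * (2 * r))"
      if r: "0 < r" "{\<xi> - r<..<\<xi> + r} \<subseteq> {\<xi>0 - r0<..<\<xi>0 + r0}" for \<xi> r
    proof -
      let ?K = "{\<xi> - r<..<\<xi> + r}"
      let ?M = "lebesgue_on ?K"
      interpret finite_measure ?M by (simp add: finite_measure_lebesgue_on)
      have vCK: "AE s in lebesgue. s \<in> ?K \<longrightarrow> v s \<in> C"
        using vC r(2) by (auto elim!: eventually_mono)
      then have vCM: "AE s in ?M. v s \<in> C" by (simp add: AE_restrict_space_iff)
      have bdK: "\<bar>s\<bar> \<le> \<bar>\<xi>\<bar> + r" if "s \<in> ?K" for s using that by auto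
      have int_v: "integrable ?M v"
      proof (rule integrable_const_bound[where B = M])
        show "AE s in ?M. norm (v s) \<le> M" using vCM by eventually_elim (rule CM)
      qed (intro measurable_restrict_space1 vm)
      have "AE s in ?M. norm (G s) \<le> F + (\<bar>\<xi>\<bar> + r) * M"
        using vCM AE_space
      proof eventually_elim
        case (elim s)
        have "norm (G s) \<le> norm (f (v s)) + \<bar>s\<bar> * norm (v s)"
          using elim norm_triangle_ineq4[of "f (v s)" "s *\<^sub>R v s"] by (simp add: G_def)
        also have "\<dots> \<le> F + (\<bar>\<xi>\<bar> + r) * M"
          using elim F CM bdK r M by (intro add_mono mult_mono) auto
        finally show ?case .
      qed
      then have int_G: "integrable ?M G"
        by (rule integrable_const_bound) (intro measurable_restrict_space1 Gm)
      have "\<exists>g. AE x in ?M. norm (G x - g) \<le> DIM(real^'n) * (2 * M * (\<xi> + r - (\<xi> - r)))"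
      proof (rule weak_derivative_oscillation_bound[OF _ M int_G int_v])
        show "AE s in ?M. norm (v s) \<le> M" using vCM by eventually_elim (rule CM)
        fix \<psi> \<phi> :: "real \<Rightarrow> real^'n" and p q
        assume a: "\<And>x. (\<psi> has_vector_derivative \<phi> x) (at x)" "continuous_on UNIV \<phi>"
          "\<xi> - r < p" "q < \<xi> + r" "\<And>x. x \<notin> {p..q} \<Longrightarrow> \<psi> x = 0" "\<And>x. x \<notin> {p..q} \<Longrightarrow> \<phi> x = 0"
        have \<phi>: "vector_derivative \<psi> (at s) = \<phi> s" for s by (rule vector_derivative_at[OF a(1)])
        have c\<psi>: "continuous_on UNIV \<psi>"
          using a(1) by (meson continuous_at_imp_continuous_on has_vector_derivative_continuous)
        have m: "\<psi> \<in> borel_measurable lebesgue" "\<phi> \<in> borel_measurable lebesgue"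
          using continuous_imp_measurable_on_sets_lebesgue[OF c\<psi>]
            continuous_imp_measurable_on_sets_lebesgue[OF a(2)] by (simp_all add: lebesgue_on_UNIV_eq)
        have hb: "has_bochner_integral lebesgue
          (\<lambda>s. \<phi> s \<bullet> (- s *\<^sub>R v s + f (v s)) - \<psi> s \<bullet> v s) 0"
          using weak[OF test_function_compact_support[OF a(1,2,5)]] by (simp add: \<phi>)
        have "(LINT s|?M. \<phi> s \<bullet> G s - \<psi> s \<bullet> v s)
            = (LINT s|lebesgue. indicator ?K s *\<^sub>R (\<phi> s \<bullet> G s - \<psi> s \<bullet> v s))"
          by (rule integral_restrict_space) auto
        \<comment> \<open>On \<open>?K\<close> the integrands agree because
          \<open>v s \<in> C\<close> almost everywhere; off \<open>?K\<close> both vanish, because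
          \<open>{p..q}\<close> lies inside \<open>?K\<close>.\<close>
        also have "\<dots> = (LINT s|lebesgue. \<phi> s \<bullet> (- s *\<^sub>R v s + f (v s)) - \<psi> s \<bullet> v s)"
        proof (rule integral_cong_AE)
          show "(\<lambda>s. \<phi> s \<bullet> (- s *\<^sub>R v s + f (v s)) - \<psi> s \<bullet> v s) \<in> borel_measurable lebesgue"
            using hb by (rule borel_measurable_has_bochner_integral)
          show "AE s in lebesgue. indicator ?K s *\<^sub>R (\<phi> s \<bullet> G s - \<psi> s \<bullet> v s)
              = \<phi> s \<bullet> (- s *\<^sub>R v s + f (v s)) - \<psi> s \<bullet> v s"
            using vCK
          proof eventually_elim
            case (elim s)
            show ?case
            proof (cases "s \<in> ?K")
              case True
              then show ?thesis using elim by (simp add: G_def algebra_simps)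
            next
              case False
              then have "s \<notin> {p..q}" using a(3,4) by auto
              then show ?thesis using False a(5,6) by simp
            qed
          qed
        qed (intro borel_measurable_scaleR borel_measurable_diff borel_measurable_inner
          borel_measurable_indicator m Gm vm, simp)
        also have "\<dots> = 0" using hb by (rule has_bochner_integral_integral_eq)
        finally show "(LINT s|?M. \<phi> s \<bullet> G s - \<psi> s \<bullet> v s) = 0" .
      qed (use r in auto)
      then show ?thesis by (simp add: AE_restrict_space_iff)
    qed
    have "\<xi> \<in> nonresonant_set f v" if "\<xi> \<in> ball \<xi>0 e" for \<xi>
    proof -
      have \<xi>: "\<bar>\<xi> - \<xi>0\<bar> < \<epsilon>" using that e by (auto simp: dist_real_def)
      \<comment> \<open>Largest radius for which the interval about \<open>\<xi>\<close> stays in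
        the window about \<open>\<xi>0\<close>.\<close>
      define R where "R = r0 - \<bar>\<xi> - \<xi>0\<bar>"
      have R: "R > 0" using that e by (auto simp: R_def dist_real_def)
      have sub: "{\<xi> - r<..<\<xi> + r} \<subseteq> {\<xi>0 - r0<..<\<xi>0 + r0}" if "r \<le> R" for r
        using that by (auto simp: R_def)
      have vC': "AE s in lebesgue. s \<in> {\<xi> - r<..<\<xi> + r} \<longrightarrow> v s \<in> C" if "r \<le> R" for r
        using vC sub[OF that] by (auto elim!: eventually_mono)
      \<comment> \<open>Otherwise \<open>v\<close> would almost everywhere avoid \<open>C\<close> on
        an interval on which it almost everywhere lies in \<open>C\<close>.\<close>
      have ne: "ess_im_at v \<xi> \<noteq> {}"
      proof
        assume "ess_im_at v \<xi> = {}"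
        then obtain r where r: "r > 0" "AE s in lebesgue. s \<in> {\<xi> - r<..<\<xi> + r} \<longrightarrow> v s \<notin> C"
          using AE_notin_compact[OF vm C(1), of \<xi>] by auto
        define r' where "r' = min r R"
        have "AE s in lebesgue. s \<notin> {\<xi> - r'<..<\<xi> + r'}"
          using r(2) vC'[OF order.refl] by eventually_elim (auto simp: r'_def)
        then have "emeasure lebesgue {\<xi> - r'<..<\<xi> + r'} = 0"
          using AE_iff_null_sets[of "{\<xi> - r'<..<\<xi> + r'}" lebesgue] by auto
        moreover have "r' > 0" using r R by (simp add: r'_def)
        ultimately show False by (simp add: emeasure_lborel_Ioo)
      qed
      have inC: "u \<in> C" if u: "u \<in> ess_im_at v \<xi>" for u
      proof (rule ccontr)
        assume "u \<notin> C"
        then have "u \<in> - C" by simp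
        then show False
          using ess_im_at_witness[OF vm u _ _ R vC'[OF order.refl], of "- C"] C(2) by (auto simp: open_Compl)
      qed
      \<comment> \<open>Per unit of \<open>r\<close>: 1 for the continuity of the shifted flux at
        \<open>u\<close>, \<open>M\<close> for replacing \<open>s\<close> by \<open>\<xi>\<close>,
        and the last term for the oscillation of \<open>G\<close>.\<close>
      define D where "D = 1 + M + DIM(real^'n) * (4 * M)"
      have D: "D > 0" using M by (auto simp: D_def intro!: add_pos_nonneg)
      \<comment> \<open>For each \<open>r\<close> a single \<open>g\<close> serves all essential
        values at \<open>\<xi>\<close>, so any two of their shifted fluxes differ by at most
        \<open>2 * D * r\<close>; \<open>g\<close> itself may vary with \<open>r\<close>.\<close>
      have close: "\<exists>g. \<forall>u\<in>ess_im_at v \<xi>. norm (f u - \<xi> *\<^sub>R u - g) \<le> D * r" if r: "0 < r" "r \<le> R" for r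
      proof -
        obtain g where g: "AE s in lebesgue. s \<in> {\<xi> - r<..<\<xi> + r} \<longrightarrow>
            norm (G s - g) \<le> DIM(real^'n) * (2 * M * (2 * r))"
          using osc[OF r(1) sub[OF r(2)]] by blast
        have P: "AE s in lebesgue. s \<in> {\<xi> - r<..<\<xi> + r} \<longrightarrow>
            v s \<in> C \<and> norm (G s - g) \<le> DIM(real^'n) * (2 * M * (2 * r))"
          using g vC'[OF r(2)] by eventually_elim auto
        show ?thesis
        proof (intro exI ballI)
          fix u assume u: "u \<in> ess_im_at v \<xi>"
          have "continuous_on U (\<lambda>w. f w - \<xi> *\<^sub>R w)" by (intro continuous_intros cf)
          then obtain d where d: "d > 0"
            "\<And>w. \<lbrakk>w \<in> U; dist w u < d\<rbrakk> \<Longrightarrow> dist (f w - \<xi> *\<^sub>R w) (f u - \<xi> *\<^sub>R u) < r"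
            using inC[OF u] C(4) r(1) unfolding continuous_on_iff by blast
          obtain s where s: "s \<in> {\<xi> - r<..<\<xi> + r}" "v s \<in> ball u d" "v s \<in> C"
              "norm (G s - g) \<le> DIM(real^'n) * (2 * M * (2 * r))"
            using ess_im_at_witness[OF vm u open_ball _ r(1) P, of u d] d(1) by auto
          have near: "norm ((f (v s) - \<xi> *\<^sub>R v s) - (f u - \<xi> *\<^sub>R u)) < r"
            using d(2)[of "v s"] s(2,3) C(4) by (simp add: dist_commute subset_iff flip: dist_norm)
          have shift: "norm ((s - \<xi>) *\<^sub>R v s) \<le> r * M"
            unfolding norm_scaleR using s(1) CM[OF s(3)] r by (intro mult_mono) auto
          have split: "f u - \<xi> *\<^sub>R u - g
              = (G s - g) + ((s - \<xi>) *\<^sub>R v s - ((f (v s) - \<xi> *\<^sub>R v s) - (f u - \<xi> *\<^sub>R u)))"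
            using s(3) by (simp add: G_def algebra_simps)
          have "norm (f u - \<xi> *\<^sub>R u - g) \<le> DIM(real^'n) * (2 * M * (2 * r)) + (r * M + r)"
            unfolding split
            by (intro order_trans[OF norm_triangle_ineq] add_mono s(4)
              order_trans[OF norm_triangle_ineq4] shift less_imp_le[OF near])
          also have "\<dots> = D * r" by (simp add: D_def algebra_simps)
          finally show "norm (f u - \<xi> *\<^sub>R u - g) \<le> D * r" .
        qed
      qed
      have "u = w" if u: "u \<in> ess_im_at v \<xi>" and w: "w \<in> ess_im_at v \<xi>" for u w
      proof -
        define h where "h = norm ((f u - \<xi> *\<^sub>R u) - (f w - \<xi> *\<^sub>R w))"
        have le: "h \<le> 2 * D * r" if r: "0 < r" "r \<le> R" for r
        proof -
          obtain g where "norm (f u - \<xi> *\<^sub>R u - g) \<le> D * r" "norm (f w - \<xi> *\<^sub>R w - g) \<le> D * r"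
            using close[OF r] u w by blast
          then have "h \<le> D * r + D * r"
            unfolding h_def by (intro norm_diff_triangle_le[of _ g]) (simp_all add: norm_minus_commute)
          then show ?thesis by simp
        qed
        have "h = 0"
        proof (rule ccontr)
          assume "h \<noteq> 0"
          then have h: "h > 0" by (simp add: h_def)
          \<comment> \<open>This choice makes \<open>2 * D * r\<close> at most
            \<open>h / 2\<close>.\<close>
          define r where "r = min R (h / (4 * D))"
          have "h \<le> 2 * D * r" by (rule le) (use R h D in \<open>auto simp: r_def\<close>)
          also have "\<dots> \<le> 2 * D * (h / (4 * D))" using D by (intro mult_left_mono) (auto simp: r_def)
          finally show False using h D by simp
        qed
        then have "f u - \<xi> *\<^sub>R u = f w - \<xi> *\<^sub>R w" by (simp add: h_def)
        then show ?thesis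
          using inj_onD[OF inj[OF \<xi>], of u w] inC[OF u] inC[OF w] by (simp add: C_def)
      qed
      then obtain u where u: "ess_im_at v \<xi> = {u}" using ne by blast
      then show ?thesis
        using det[OF \<xi>, of u] inC[of u]
        by (simp add: nonresonant_set_def ess_im_continuity_point_def ess_im_value_def C_def)
    qed
    then show ?thesis using e by blast
  qed
  then show ?thesis unfolding open_contains_ball by blast
qed

theorem proposition8p1:
  fixes U :: "(real^'n) set"
    and f :: "real^'n \<Rightarrow> real^'n"
    and v :: "real \<Rightarrow> real^'n"
  assumes "open U"
    and "C2_on f U"
    and "convex hull (strictly_hyperbolic_set f U) \<subseteq> U"
    and "self_similar_weak_solution f U v"
  shows "closed (discontinuity_set v \<union> resonant_set f v) \<and> open (nonresonant_set f v)"
proof -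
  have "discontinuity_set v \<union> resonant_set f v = - nonresonant_set f v"
    by (auto simp: discontinuity_set_def nonresonant_set_def resonant_set_def)
  then show ?thesis
    using open_nonresonant_set[OF assms(1,2,4)] by (simp add: closed_def)
qed

end
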